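(* Let $K\subset\mathbb{R}^n$ be a nontrivial closed convex pointed cone, suppose $0\notin\operatorname{cl}\operatorname{aff}(E_K)$, and set $d:=-P_{\operatorname{cl}\operatorname{aff}(E_K)}(0)$. For $w\in\mathbb{R}^n\setminus\{0\}$ set $\rho_K(w):=\sup\{t\ge0:d+tw\in K^\circ\}\in[0,+\infty]$. Then $$\rho_K(w)=\begin{cases}+\infty, & \sup_{u\in E_K}\langle w,u\rangle\le0,\\[1mm]\dfrac{\|d\|^2}{\sup_{u\in E_K}\langle w,u\rangle}, & \text{otherwise.}\end{cases}$$ The infimum of $\rho_K$ over the unit sphere equals $\|d\|^2$ and is attained on $\operatorname{cl}E_K$.
   Context: $\langle\cdot,\cdot\rangle$ and $\|\cdot\|$ are the Euclidean inner product and norm on $\mathbb{R}^n$, and $\operatorname{cl}$ denotes closure. Nontrivial means $K\ne\{0\}$; pointed means $K\cap(-K)=\{0\}$. The extremal section of $K$ is $E_K:=\{u\in\mathbb{R}^n:\|u\|=1,\ \mathbb{R}_+u\text{ is an extreme ray of }K\}$. The polar cone is $K^\circ=\{w\in\mathbb{R}^n:\langle w,z\rangle\le0\ \text{for all }z\in K\}$. $\operatorname{aff}$ denotes affine hull and $P_A$ denotes orthogonal projection onto a nonempty closed affine set $A$. *)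

theory Defs
  imports "HOL-Analysis.Analysis"
begin

definition ray :: "'a::real_vector \<Rightarrow> 'a set" where
  "ray u = {t *\<^sub>R u | t. 0 \<le> t}"

text \<open>An extreme ray of a convex cone is a face that is a closed half-line from the origin.\<close>

definition extreme_ray :: "'a::real_vector set \<Rightarrow> 'a set \<Rightarrow> bool" where
  "extreme_ray K R \<longleftrightarrow> R face_of K \<and> (\<exists>u. u \<noteq> 0 \<and> R = ray u)"

definition pointed :: "'a::real_vector set \<Rightarrow> bool" where
  "pointed K \<longleftrightarrow> K \<inter> uminus ` K = {0}"

definition extremal_section :: "'a::real_normed_vector set \<Rightarrow> 'a set" where
  "extremal_section K = {u. norm u = 1 \<and> extreme_ray K (ray u)}"

definition polar_cone :: "'a::real_inner set \<Rightarrow> 'a set" where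
  "polar_cone K = {w. \<forall>z\<in>K. w \<bullet> z \<le> 0}"

definition polar_center :: "'a::euclidean_space set \<Rightarrow> 'a" where
  "polar_center K = - closest_point (closure (affine hull (extremal_section K))) 0"

text \<open>The supremum is taken in the extended reals, so that it is \<open>\<infinity>\<close> when the
  admissible step lengths are unbounded.\<close>

definition polar_reach :: "'a::euclidean_space set \<Rightarrow> 'a \<Rightarrow> ereal" where
  "polar_reach K w =
     (SUP t\<in>{t::real. 0 \<le> t \<and> polar_center K + t *\<^sub>R w \<in> polar_cone K}. ereal t)"

end

theory Submission
  imports Defs
begin

text \<open>
  A closed pointed convex cone has a compact slice, whose extreme points span the extreme rays of the
  cone; by Krein--Milman, membership in the polar cone can thus be tested on the extremal section
  alone. The vector \<open>-d\<close> is orthogonal to the directions of the affine hull of the extremal section,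
  so \<open>\<langle>d, u\<rangle> = -\<parallel>d\<parallel>\<^sup>2\<close> for every \<open>u\<close> in the section, and \<open>d + t w\<close> lies in the polar cone iff
  \<open>t * sup \<langle>w, u\<rangle> \<le> \<parallel>d\<parallel>\<^sup>2\<close>. On the unit sphere that supremum is at most 1, with equality on the
  closure of the section.
\<close>

section \<open>Compact slices of a pointed cone and its extreme rays\<close>

lemma ray_scaleR:
  assumes "0 < c"
  shows "ray (c *\<^sub>R u) = ray u"
proof -
  have "\<exists>s. t *\<^sub>R u = s *\<^sub>R c *\<^sub>R u \<and> 0 \<le> s" if "0 \<le> t" for t
    using assms that by (intro exI[of _ "t / c"]) simp
  then show ?thesis
    using assms by (fastforce simp: ray_def)
qed

text \<open>Pointedness keeps a convex combination of nonzero elements of \<open>K\<close> from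
  vanishing, so \<open>K - {0}\<close> is convex and contains the hull of the compact set
  \<open>K \<inter> sphere 0 1\<close>. That hull is compact and misses 0, hence is strictly
  separated from 0; homogeneity spreads the bound over \<open>K\<close>.\<close>

lemma pointed_cone_positive_functional:
  fixes K :: "'a::euclidean_space set"
  assumes "closed K" "convex K" "cone K" "pointed K"
  obtains g b where "0 < b" "\<And>x. x \<in> K \<Longrightarrow> b * norm x \<le> g \<bullet> x"
proof -
  have "convex (K - {0})"
  proof (rule convexI)
    fix x y :: 'a and u v :: real
    assume xy: "x \<in> K - {0}" "y \<in> K - {0}" and uv: "0 \<le> u" "0 \<le> v" "u + v = 1"
    have "u *\<^sub>R x + v *\<^sub>R y \<noteq> 0"
    proof
      assume "u *\<^sub>R x + v *\<^sub>R y = 0"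
      then have eq: "u *\<^sub>R x = - (v *\<^sub>R y)"
        by (simp add: eq_neg_iff_add_eq_0)
      moreover have "u *\<^sub>R x \<in> K" "v *\<^sub>R y \<in> K"
        using xy uv \<open>cone K\<close> by (auto simp: cone_def)
      ultimately have "u *\<^sub>R x \<in> K \<inter> uminus ` K"
        by auto
      then have "u *\<^sub>R x = 0"
        using \<open>pointed K\<close> unfolding pointed_def by blast
      with eq xy uv show False
        by auto
    qed
    moreover have "u *\<^sub>R x + v *\<^sub>R y \<in> K"
      using xy uv \<open>convex K\<close> by (auto intro: convexD)
    ultimately show "u *\<^sub>R x + v *\<^sub>R y \<in> K - {0}"
      by simp
  qed
  then have "convex hull (K \<inter> sphere 0 1) \<subseteq> K - {0}"
    by (intro hull_minimal) auto
  then have "0 \<notin> convex hull (K \<inter> sphere 0 1)"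
    by blast
  moreover have "closed (convex hull (K \<inter> sphere 0 1))"
    using \<open>closed K\<close> by (simp add: compact_imp_closed compact_convex_hull closed_Int_compact)
  ultimately obtain g b where b: "0 < b" and g: "\<And>x. x \<in> convex hull (K \<inter> sphere 0 1) \<Longrightarrow> b < g \<bullet> x"
    using separating_hyperplane_closed_0[OF convex_convex_hull] by metis
  have "b * norm x \<le> g \<bullet> x" if "x \<in> K" for x
  proof (cases "x = 0")
    case False
    then have "(1 / norm x) *\<^sub>R x \<in> K \<inter> sphere 0 1"
      using that \<open>cone K\<close> by (auto simp: cone_def)
    then have "b < g \<bullet> ((1 / norm x) *\<^sub>R x)"
      by (intro g hull_inc)
    with False show ?thesis
      by (simp add: field_simps)
  qed simp
  with b show thesis
    by (rule that)
qed

text \<open>If an open segment in \<open>K\<close> meets the ray, rescaling its endpoints into the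
  slice where \<open>g\<close> equals 1 exhibits \<open>x\<close> as a proper convex combination of
  them, and extremality makes both rescaled endpoints equal to \<open>x\<close>.\<close>

lemma extreme_ray_of_slice_extreme_point:
  fixes K :: "'a::real_inner set"
  assumes "cone K" and pos: "\<And>y. y \<in> K \<Longrightarrow> y \<noteq> 0 \<Longrightarrow> 0 < g \<bullet> y"
    and ext: "x extreme_point_of (K \<inter> {y. g \<bullet> y = 1})"
  shows "extreme_ray K (ray x)"
proof -
  have x: "x \<in> K" "g \<bullet> x = 1" "x \<noteq> 0"
    using ext by (auto simp: extreme_point_of_def)
  have "ray x \<subseteq> K"
    using x \<open>cone K\<close> by (auto simp: ray_def cone_def)
  moreover have "convex (ray x)"
  proof (rule convexI)
    fix y z :: 'a and u v :: real
    assume "y \<in> ray x" "z \<in> ray x" and uv: "0 \<le> u" "0 \<le> v"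
    then obtain s t where "y = s *\<^sub>R x" "0 \<le> s" "z = t *\<^sub>R x" "0 \<le> t"
      by (auto simp: ray_def)
    then have "u *\<^sub>R y + v *\<^sub>R z = (u * s + v * t) *\<^sub>R x" "0 \<le> u * s + v * t"
      using uv by (auto simp: algebra_simps)
    then show "u *\<^sub>R y + v *\<^sub>R z \<in> ray x"
      unfolding ray_def by blast
  qed
  moreover have "a \<in> ray x \<and> b \<in> ray x"
    if K: "a \<in> K" "b \<in> K" and z: "z \<in> ray x" "z \<in> open_segment a b" for a b z
  proof -
    obtain t where t: "z = t *\<^sub>R x" "0 \<le> t"
      using z by (auto simp: ray_def)
    obtain u where u: "0 < u" "u < 1" "z = (1 - u) *\<^sub>R a + u *\<^sub>R b" "a \<noteq> b"
      using z by (auto simp: in_segment)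
    have 0: "0 \<in> ray x"
      by (auto simp: ray_def intro: exI[of _ 0])
    \<comment> \<open>Only nonzero endpoints can be normalised by \<open>g\<close>. If one endpoint
      is 0, the other is a positive multiple of \<open>z\<close> and so lies on the ray.\<close>
    consider "a = 0" | "b = 0" | "a \<noteq> 0" "b \<noteq> 0"
      by blast
    then show ?thesis
    proof cases
      case 1
      have "b = (1 / u) *\<^sub>R u *\<^sub>R b"
        using u by simp
      also have "u *\<^sub>R b = t *\<^sub>R x"
        using 1 t u by simp
      finally have "b = (t / u) *\<^sub>R x"
        by simp
      then have "b \<in> ray x"
        using t u by (auto simp: ray_def intro!: exI[of _ "t / u"])
      with 0 1 show ?thesis
        by simp
    next
      case 2
      have "a = (1 / (1 - u)) *\<^sub>R (1 - u) *\<^sub>R a"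
        using u by simp
      also have "(1 - u) *\<^sub>R a = t *\<^sub>R x"
        using 2 t u by simp
      finally have "a = (t / (1 - u)) *\<^sub>R x"
        by simp
      then have "a \<in> ray x"
        using t u by (auto simp: ray_def intro!: exI[of _ "t / (1 - u)"])
      with 0 2 show ?thesis
        by simp
    next
      case 3
      define p q where "p = g \<bullet> a" and "q = g \<bullet> b"
      have pq: "0 < p" "0 < q"
        using 3 K pos by (auto simp: p_def q_def)
      define a' b' where "a' = (1 / p) *\<^sub>R a" and "b' = (1 / q) *\<^sub>R b"
      have S: "a' \<in> K \<inter> {y. g \<bullet> y = 1}" "b' \<in> K \<inter> {y. g \<bullet> y = 1}"
        using pq K \<open>cone K\<close> by (auto simp: a'_def b'_def cone_def p_def q_def)
      have ab: "a = p *\<^sub>R a'" "b = q *\<^sub>R b'"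
        using pq by (auto simp: a'_def b'_def)
      have "t = g \<bullet> z"
        using x t by simp
      also have "\<dots> = (1 - u) * p + u * q"
        by (simp add: u inner_add_right p_def q_def)
      finally have t_eq: "t = (1 - u) * p + u * q" .
      then have "0 < t"
        using u pq by (simp add: add_pos_pos)
      \<comment> \<open>Dividing \<open>z\<close> by \<open>t\<close> gives \<open>a'\<close> and
        \<open>b'\<close> the weights \<open>(1 - u) * p / t\<close> and \<open>u * q / t\<close>;
        by \<open>t_eq\<close> they sum to 1.\<close>
      define v where "v = u * q / t"
      have v: "0 < v" "v < 1" "1 - v = (1 - u) * p / t"
        using \<open>0 < t\<close> u pq by (simp_all add: v_def field_simps t_eq)
      have "x = (1 / t) *\<^sub>R z"
        using t \<open>0 < t\<close> by simp
      also have "\<dots> = (1 - v) *\<^sub>R a' + v *\<^sub>R b'"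
        unfolding v(3) by (simp add: u(3) ab v_def scaleR_add_right)
      finally have x_eq: "x = (1 - v) *\<^sub>R a' + v *\<^sub>R b'" .
      have "a' = b'"
      proof (rule ccontr)
        assume "a' \<noteq> b'"
        then have "x \<in> open_segment a' b'"
          using v x_eq by (auto simp: in_segment)
        with ext S show False
          unfolding extreme_point_of_def by blast
      qed
      with x_eq have "a' = x" "b' = x"
        by (auto simp: algebra_simps)
      with ab pq show ?thesis
        by (auto simp: ray_def)
    qed
  qed
  ultimately have "ray x face_of K"
    unfolding face_of_def by blast
  with x show ?thesis
    unfolding extreme_ray_def by blast
qed

section \<open>Testing polarity on the extremal section\<close>

lemma extremal_section_subset: "extremal_section K \<subseteq> K \<inter> sphere 0 1"
proof
  fix u assume u: "u \<in> extremal_section K"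
  then have "ray u \<subseteq> K"
    by (auto simp: extremal_section_def extreme_ray_def dest: face_of_imp_subset)
  moreover have "u \<in> ray u"
    by (auto simp: ray_def intro!: exI[of _ 1])
  ultimately show "u \<in> K \<inter> sphere 0 1"
    using u by (auto simp: extremal_section_def)
qed

text \<open>The content is the passage from the section to all of \<open>K\<close>. The slice
  \<open>S\<close> is bounded by the coercivity of \<open>g\<close>, hence compact and the hull of
  its extreme points. A half-space containing these contains \<open>S\<close>, and scaling carries
  the inequality to \<open>K\<close>.\<close>

lemma polar_cone_iff_extremal_section:
  fixes K :: "'a::euclidean_space set"
  assumes "closed K" "convex K" "cone K" "pointed K"
  shows "w \<in> polar_cone K \<longleftrightarrow> (\<forall>u\<in>extremal_section K. w \<bullet> u \<le> 0)"
proof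
  assume "w \<in> polar_cone K"
  then show "\<forall>u\<in>extremal_section K. w \<bullet> u \<le> 0"
    using extremal_section_subset[of K] by (auto simp: polar_cone_def)
next
  assume w: "\<forall>u\<in>extremal_section K. w \<bullet> u \<le> 0"
  obtain g b where b: "0 < b" and g: "\<And>x. x \<in> K \<Longrightarrow> b * norm x \<le> g \<bullet> x"
    using pointed_cone_positive_functional assms by metis
  have pos: "0 < g \<bullet> x" if "x \<in> K" "x \<noteq> 0" for x
  proof -
    have "0 < b * norm x"
      using b that by simp
    with g[OF that(1)] show ?thesis
      by linarith
  qed
  define S where "S = K \<inter> {x. g \<bullet> x = 1}"
  have "norm x \<le> 1 / b" if "x \<in> S" for x
    using g[of x] b that by (simp add: S_def field_simps)
  then have "bounded S"
    by (rule boundedI)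
  moreover have "closed S"
    unfolding S_def using \<open>closed K\<close> by (intro closed_Int closed_hyperplane)
  ultimately have "compact S"
    by (simp add: compact_eq_bounded_closed)
  moreover have "convex S"
    unfolding S_def using \<open>convex K\<close> by (intro convex_Int convex_hyperplane)
  ultimately have S: "S = convex hull {x. x extreme_point_of S}"
    by (rule Krein_Milman_Minkowski)
  have "{x. x extreme_point_of S} \<subseteq> {x. w \<bullet> x \<le> 0}"
  proof clarify
    fix x assume x: "x extreme_point_of S"
    then have "extreme_ray K (ray x)"
      using extreme_ray_of_slice_extreme_point \<open>cone K\<close> pos unfolding S_def by blast
    moreover have "x \<noteq> 0"
      using x by (auto simp: extreme_point_of_def S_def)
    \<comment> \<open>Normalising an extreme point of the slice to unit length does not change the
      ray it spans.\<close>
    ultimately have "(1 / norm x) *\<^sub>R x \<in> extremal_section K"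
      by (simp add: extremal_section_def ray_scaleR del: scaleR_eq_0_iff)
    with w have "w \<bullet> ((1 / norm x) *\<^sub>R x) \<le> 0"
      by blast
    with \<open>x \<noteq> 0\<close> show "w \<bullet> x \<le> 0"
      by (simp add: divide_le_0_iff)
  qed
  then have le: "S \<subseteq> {x. w \<bullet> x \<le> 0}"
    by (subst S) (intro hull_minimal convex_halfspace_le)
  have "w \<bullet> z \<le> 0" if z: "z \<in> K" for z
  proof (cases "z = 0")
    case False
    then have gz: "0 < g \<bullet> z"
      using pos z by blast
    then have "(1 / (g \<bullet> z)) *\<^sub>R z \<in> S"
      using z \<open>cone K\<close> by (auto simp: S_def cone_def)
    with le have "w \<bullet> ((1 / (g \<bullet> z)) *\<^sub>R z) \<le> 0"
      by blast
    with gz show ?thesis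
      by (simp add: divide_le_0_iff)
  qed simp
  then show "w \<in> polar_cone K"
    by (simp add: polar_cone_def)
qed

text \<open>Over an empty section the polarity test is vacuous, so each \<open>z\<close> in
  \<open>K\<close> would be polar to itself, forcing \<open>z = 0\<close>.\<close>

lemma extremal_section_nonempty:
  fixes K :: "'a::euclidean_space set"
  assumes "closed K" "convex K" "cone K" "pointed K" "K \<noteq> {0}"
  shows "extremal_section K \<noteq> {}"
proof
  assume "extremal_section K = {}"
  then have "z \<in> polar_cone K" for z
    using polar_cone_iff_extremal_section assms by blast
  then have "z \<bullet> z \<le> 0" if "z \<in> K" for z
    using that unfolding polar_cone_def by blast
  then have "z = 0" if "z \<in> K" for z
    using that by (metis inner_ge_zero inner_eq_zero_iff order_antisym)
  moreover have "0 \<in> K"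
    using \<open>pointed K\<close> by (auto simp: pointed_def)
  ultimately show False
    using \<open>K \<noteq> {0}\<close> by auto
qed

section \<open>The projection of the origin onto an affine set\<close>

lemma inner_closest_point_affine:
  fixes A :: "'a::euclidean_space set"
  assumes "affine A" "closed A" "x \<in> A"
  shows "closest_point A 0 \<bullet> x = (norm (closest_point A 0))\<^sup>2"
proof -
  let ?p = "closest_point A 0"
  have p: "?p \<in> A"
    using assms by (intro closest_point_in_set) auto
  \<comment> \<open>The reflection of \<open>x\<close> through \<open>?p\<close> stays in
    \<open>A\<close>. The obtuse-angle inequalities at \<open>x\<close> and at its reflection have
    opposite signs, so both are equalities.\<close>
  have "2 *\<^sub>R ?p + (-1) *\<^sub>R x \<in> A"
    using assms(1,3) p by (intro mem_affine) auto
  then have "(0 - ?p) \<bullet> (2 *\<^sub>R ?p + (-1) *\<^sub>R x - ?p) \<le> 0" "(0 - ?p) \<bullet> (x - ?p) \<le> 0"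
    using assms by (intro closest_point_dot affine_imp_convex; simp)+
  then show ?thesis
    by (simp add: power2_norm_eq_inner algebra_simps)
qed

lemma polar_center_inner:
  fixes K :: "'a::euclidean_space set"
  assumes "u \<in> extremal_section K"
  shows "polar_center K \<bullet> u = - (norm (polar_center K))\<^sup>2"
  using inner_closest_point_affine[of "affine hull (extremal_section K)" u] assms
  by (simp add: polar_center_def hull_inc closure_closed)

section \<open>The reach as a supremum of admissible step lengths\<close>

lemma bdd_above_inner_bounded:
  fixes S :: "'a::real_inner set"
  assumes "bounded S"
  shows "bdd_above ((\<lambda>u. w \<bullet> u) ` S)"
  using bounded_linear_image[OF assms bounded_linear_inner_right] by (rule bounded_imp_bdd_above)

lemma bounded_extremal_section: "bounded (extremal_section K)"
  by (rule bounded_subset[OF bounded_cball[of 0 1]]) (auto simp: extremal_section_def)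

lemma polar_reach_eq:
  fixes K :: "'a::euclidean_space set"
  assumes "closed K" "convex K" "cone K" "pointed K" "K \<noteq> {0}"
  defines "\<sigma> \<equiv> \<lambda>w. SUP u\<in>extremal_section K. w \<bullet> u"
  shows "polar_reach K w =
    (if \<sigma> w \<le> 0 then \<infinity> else ereal ((norm (polar_center K))\<^sup>2 / \<sigma> w))"
proof -
  let ?E = "extremal_section K" and ?r = "(norm (polar_center K))\<^sup>2"
  \<comment> \<open>The real-valued \<open>SUP\<close> is a genuine least upper bound only for a
    nonempty set bounded above, hence \<open>E\<close> and \<open>bdd\<close>.\<close>
  have E: "?E \<noteq> {}"
    using assms by (intro extremal_section_nonempty)
  have bdd: "bdd_above ((\<lambda>u. w \<bullet> u) ` ?E)"
    by (intro bdd_above_inner_bounded bounded_extremal_section)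
  have upper: "w \<bullet> u \<le> \<sigma> w" if "u \<in> ?E" for u
    unfolding \<sigma>_def using bdd that by (intro cSUP_upper)
  have mem: "polar_center K + t *\<^sub>R w \<in> polar_cone K \<longleftrightarrow> t * \<sigma> w \<le> ?r" if t: "0 \<le> t" for t
  proof -
    have "polar_center K + t *\<^sub>R w \<in> polar_cone K \<longleftrightarrow> (\<forall>u\<in>?E. t * (w \<bullet> u) \<le> ?r)"
      using assms by (simp add: polar_cone_iff_extremal_section inner_add_left polar_center_inner)
    also have "\<dots> \<longleftrightarrow> t * \<sigma> w \<le> ?r"
    proof
      assume le: "\<forall>u\<in>?E. t * (w \<bullet> u) \<le> ?r"
      show "t * \<sigma> w \<le> ?r"
      proof (cases "t = 0")
        case False
        then have "w \<bullet> u \<le> ?r / t" if "u \<in> ?E" for u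
          using t le that by (simp add: field_simps)
        then have "\<sigma> w \<le> ?r / t"
          unfolding \<sigma>_def using E by (intro cSUP_least)
        with False t show ?thesis
          by (simp add: field_simps)
      qed simp
    next
      assume "t * \<sigma> w \<le> ?r"
      then show "\<forall>u\<in>?E. t * (w \<bullet> u) \<le> ?r"
        using mult_left_mono[OF upper t] order_trans by blast
    qed
    finally show ?thesis .
  qed
  \<comment> \<open>The problem is now scalar: the admissible \<open>t\<close> form a half-line or a
    bounded interval, according to the sign of \<open>\<sigma> w\<close>.\<close>
  have reach: "polar_reach K w = (SUP t\<in>{t. 0 \<le> t \<and> t * \<sigma> w \<le> ?r}. ereal t)"
    unfolding polar_reach_def using mem by (intro SUP_cong) auto
  show ?thesis
  proof (cases "\<sigma> w \<le> 0")
    case True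
    then have "t * \<sigma> w \<le> ?r" if "0 \<le> t" for t
      using that mult_nonneg_nonpos[of t "\<sigma> w"] zero_le_power2[of "norm (polar_center K)"]
      by linarith
    then have all: "{t. 0 \<le> t \<and> t * \<sigma> w \<le> ?r} = {0..}"
      by auto
    have "(SUP t\<in>{0..}. ereal t) = \<infinity>"
      \<comment> \<open>Each natural number is itself an admissible index, so it serves as its own
        witness.\<close>
      by (rule SUP_PInfty) (metis atLeast_iff ereal_less_eq(3) of_nat_0_le_iff order_refl)
    with True reach all show ?thesis
      by simp
  next
    case False
    then have "{t. 0 \<le> t \<and> t * \<sigma> w \<le> ?r} = {0..?r / \<sigma> w}"
      by (auto simp: field_simps)
    \<comment> \<open>The right endpoint is nonnegative, so it belongs to the interval and is its
      maximum.\<close>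
    moreover have "(SUP t\<in>{0..?r / \<sigma> w}. ereal t) = ereal (?r / \<sigma> w)"
      using False by (intro SUP_eqI) auto
    ultimately show ?thesis
      using False reach by simp
  qed
qed

text \<open>Attainment is expressed at every point of the closure of the section; the nonemptiness
  conjunct keeps this from being vacuous.\<close>

theorem corollary6p5:
  fixes K :: "(real ^ 'n) set"
  assumes "closed K" and "convex K" and "cone K" and "pointed K" and "K \<noteq> {0}"
    and "0 \<notin> closure (affine hull (extremal_section K))"
  shows "(\<forall>w. w \<noteq> 0 \<longrightarrow>
            polar_reach K w =
              (if (SUP u\<in>extremal_section K. w \<bullet> u) \<le> 0 then \<infinity>
               else ereal ((norm (polar_center K))\<^sup>2 / (SUP u\<in>extremal_section K. w \<bullet> u))))
       \<and> (INF w\<in>sphere 0 1. polar_reach K w) = ereal ((norm (polar_center K))\<^sup>2)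
       \<and> closure (extremal_section K) \<noteq> {}
       \<and> (\<forall>w\<in>closure (extremal_section K).
            w \<in> sphere 0 1 \<and> polar_reach K w = ereal ((norm (polar_center K))\<^sup>2))"
proof -
  let ?E = "extremal_section K" and ?r = "(norm (polar_center K))\<^sup>2"
  let ?s = "\<lambda>w. SUP u\<in>?E. w \<bullet> u"
  have reach: "polar_reach K w = (if ?s w \<le> 0 then \<infinity> else ereal (?r / ?s w))" for w
    using assms(1-5) by (rule polar_reach_eq)
  have E: "?E \<noteq> {}"
    using assms(1-5) by (rule extremal_section_nonempty)
  have s_le: "?s w \<le> 1" if "norm w = 1" for w
  proof (rule cSUP_least[OF E])
    fix u assume "u \<in> ?E"
    then show "w \<bullet> u \<le> 1"
      using norm_cauchy_schwarz[of w u] that by (simp add: extremal_section_def)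
  qed
  have closure_sphere: "closure ?E \<subseteq> sphere 0 1"
    using extremal_section_subset[of K] by (intro closure_minimal) auto
  have s_eq: "?s w = 1" if w: "w \<in> closure ?E" for w
  proof (rule antisym)
    have norm_w: "norm w = 1"
      using closure_sphere w by auto
    then show "?s w \<le> 1"
      by (rule s_le)
    \<comment> \<open>\<open>w\<close> need not lie in \<open>?E\<close> itself, but the half-space
      is closed, so the bound extends to the closure and may be evaluated at \<open>u = w\<close>,
      where the inner product is 1.\<close>
    have "u \<in> {u. w \<bullet> u \<le> ?s w}" if "u \<in> closure ?E" for u
      using that
    proof (rule set_mp[OF closure_minimal, rotated -1])
      show "?E \<subseteq> {u. w \<bullet> u \<le> ?s w}"
        by (auto intro!: cSUP_upper bdd_above_inner_bounded bounded_extremal_section)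
    qed (rule closed_halfspace_le)
    from this[OF w] norm_w show "1 \<le> ?s w"
      by (simp add: dot_square_norm)
  qed
  have attained: "polar_reach K w = ereal ?r" if "w \<in> closure ?E" for w
    using reach[of w] s_eq[OF that] by simp
  have lower: "ereal ?r \<le> polar_reach K w" if "w \<in> sphere 0 1" for w
  proof (cases "?s w \<le> 0")
    case False
    \<comment> \<open>Dividing by the positive \<open>?s w\<close> yields
      \<open>?r \<le> ?r / ?s w\<close>, the finite case of the bound.\<close>
    have "?r * ?s w \<le> ?r * 1"
      using s_le that by (intro mult_left_mono) auto
    with False reach show ?thesis
      by (simp add: field_simps)
  qed (simp add: reach)
  obtain u where u: "u \<in> ?E"
    using E by blast
  have "(INF w\<in>sphere 0 1. polar_reach K w) = ereal ?r"
  proof (rule antisym)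
    show "(INF w\<in>sphere 0 1. polar_reach K w) \<le> ereal ?r"
      using INF_lower[of u "sphere 0 1" "polar_reach K"] attained closure_sphere u closure_subset
      by force
    show "ereal ?r \<le> (INF w\<in>sphere 0 1. polar_reach K w)"
      using lower by (rule INF_greatest)
  qed
  with reach E attained closure_sphere show ?thesis
    by auto
qed

end
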